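(* Let $G$ be a cyclic group of order $n>1000$, $g\in G$ with $\mathrm{ord}(g)=n$, and let $S=(x_1g)\cdot(x_2g)\cdot(x_3g)\cdot(x_4g)$ be a minimal zero-sum sequence over $G$ with $1\le x_1,x_2,x_3,x_4\le n-1$. Let $\mathcal{T}$ be the set of prime divisors of $n$. If $S$ is reduced and $\gcd(x_1,x_2,x_3,x_4,n)=1$, then $|\mathcal{T}|\le 3$. Moreover, if $|\mathcal{T}|=3$, then after renumbering the $x_i$ and labeling the three primes dividing $n$ as $p_1,p_2,p_3$ suitably, one of the following holds: (A1) the multiset $\{\gcd(x_i,n): i=1,2,3,4\}$ equals $\{p_1p_2,\,p_2,\,p_1p_3,\,p_3\}$; (A2) the multiset $\{\gcd(x_i,n): i=1,2,3,4\}$ equals $\{1,\,p_1,\,p_2,\,p_1p_2\}$; (A3) $\gcd(x_i,n)=1$ for $i=1,2,3,4$; (A4) $\gcd(x_1,n)=1$, $\gcd(x_2,n)=p_1p_2$, $\gcd(x_3,n)=p_1p_3$, $\gcd(x_4,n)=p_2p_3$.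
   Context: A sequence over $G$ is a finite unordered list of elements of $G$ with repetition allowed, written multiplicatively. It is zero-sum if the sum of its terms is $0$, and minimal zero-sum if it is zero-sum and no proper nonempty subsequence is zero-sum. The minimal zero-sum sequence $S=(x_1g)\cdot\ldots\cdot(x_4g)$ is reduced if for every prime $p$ dividing $n$ the sequence $(px_1g)\cdot(px_2g)\cdot(px_3g)\cdot(px_4g)$ is not a minimal zero-sum sequence. *)

theory Defs
  imports "HOL-Algebra.Algebra" "HOL-Library.Multiset" "HOL-Combinatorics.Permutations"
begin

text \<open>
  Groups are records in the multiplicative notation of HOL-Algebra: the sum of group elements
  is \<open>\<otimes>\<close>, the zero element is \<open>\<one>\<close>, and the multiple \<open>k g\<close> is \<open>g [^] k\<close>.
  A sequence over \<open>G\<close> is a multiset of elements of \<open>carrier G\<close>, and its subsequences are its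
  submultisets.
\<close>

text \<open>The sum of the terms of \<open>S\<close>, collected by multiplicity: \<open>\<Sum> v\<^sub>h(S) h\<close> over the support of \<open>S\<close>.\<close>

definition seq_sum :: "('a, 'b) monoid_scheme \<Rightarrow> 'a multiset \<Rightarrow> 'a" where
  "seq_sum G S = finprod G (\<lambda>h. h [^]\<^bsub>G\<^esub> count S h) (set_mset S)"

definition zero_sum :: "('a, 'b) monoid_scheme \<Rightarrow> 'a multiset \<Rightarrow> bool" where
  "zero_sum G S \<longleftrightarrow> set_mset S \<subseteq> carrier G \<and> seq_sum G S = \<one>\<^bsub>G\<^esub>"

definition minimal_zero_sum :: "('a, 'b) monoid_scheme \<Rightarrow> 'a multiset \<Rightarrow> bool" where
  "minimal_zero_sum G S \<longleftrightarrow>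
     zero_sum G S \<and> (\<forall>T. T \<subset># S \<and> T \<noteq> {#} \<longrightarrow> \<not> zero_sum G T)"

text \<open>For a finite cyclic group \<open>G\<close>, the primes \<open>p\<close> range over the prime divisors of \<open>|G|\<close>;
  multiplying every term \<open>h\<close> by \<open>p\<close> turns \<open>x\<^sub>i g\<close> into \<open>p x\<^sub>i g\<close>.\<close>

definition reduced_seq :: "('a, 'b) monoid_scheme \<Rightarrow> 'a multiset \<Rightarrow> bool" where
  "reduced_seq G S \<longleftrightarrow>
     (\<forall>p::nat. Factorial_Ring.prime p \<and> p dvd order G \<longrightarrow>
        \<not> minimal_zero_sum G (image_mset (\<lambda>h. h [^]\<^bsub>G\<^esub> p) S))"

end

(*
  Since S is reduced, every prime p dividing n has a proper nonempty index set I(p) with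
  n | p * (sum of x over I(p)), and we may replace I(p) by its complement. The index sets modulo
  complements are the seven points of the Fano plane, and p divides the sum over I(q) for every
  other prime q, while minimality makes the points I(p) distinct. A prime dividing the sums over
  three noncollinear points divides all x_i, which the gcd condition forbids. Hence for four
  primes any three of the four points would be collinear, which is impossible. For three primes
  with collinear points, the three points are {1,2}, {1,3}, {2,3}, because on every other line one
  sum is the sum of the other two; no x_i is then divisible by a prime factor of n. If the points
  are not collinear, n is squarefree, p divides x_i exactly if the point of x_i lies on the line
  through the two points of the other primes, and the number of two-element points among the
  three decides between the remaining patterns.
*)
theory Submission
  imports Defs
begin

section \<open>Zero-sum sequences of powers of one element\<close>

text \<open>\<open>seq_sum\<close> groups equal terms into powers; this recursion restores the
  term-by-term view that induction needs.\<close>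

lemma (in comm_group) seq_sum_add_mset:
  assumes "h \<in> carrier G" "set_mset T \<subseteq> carrier G"
  shows "seq_sum G (add_mset h T) = h \<otimes> seq_sum G T"
proof -
  let ?f = "\<lambda>T k. k [^] count T k"
  let ?R = "finprod G (?f T) (set_mset T - {h})"
  have R: "?R \<in> carrier G"
    using assms by (intro finprod_closed) auto
  have eq: "finprod G (?f (add_mset h T)) (set_mset T - {h}) = ?R"
    using assms by (intro finprod_cong') auto
  have "seq_sum G (add_mset h T) = finprod G (?f (add_mset h T)) (insert h (set_mset T - {h}))"
    by (simp add: seq_sum_def)
  also have "\<dots> = (h [^] Suc (count T h)) \<otimes> finprod G (?f (add_mset h T)) (set_mset T - {h})"
    using assms by (subst finprod_insert) auto
  also have "\<dots> = h \<otimes> (h [^] count T h \<otimes> ?R)"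
    unfolding eq using assms(1) R by (simp add: m_ac)
  also have "h [^] count T h \<otimes> ?R = seq_sum G T"
  proof (cases "h \<in># T")
    case True
    have "seq_sum G T = finprod G (?f T) (insert h (set_mset T - {h}))"
      using True by (simp add: seq_sum_def insert_absorb)
    also have "\<dots> = h [^] count T h \<otimes> ?R"
      using assms by (subst finprod_insert) auto
    finally show ?thesis by simp
  next
    case False
    then show ?thesis using R by (simp add: seq_sum_def not_in_iff)
  qed
  finally show ?thesis .
qed

lemma (in comm_group) seq_sum_pow:
  assumes "g \<in> carrier G" "finite A"
  shows "seq_sum G {# g [^] y i. i \<in># mset_set A #} = g [^] (sum y A :: nat)"
  using assms(2)
proof (induction A rule: finite_induct)
  case empty
  then show ?case by (simp add: seq_sum_def)
next
  case (insert i A)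
  then have "seq_sum G {# g [^] y i. i \<in># mset_set (insert i A) #} = g [^] y i \<otimes> g [^] sum y A"
    using assms(1) by (simp add: seq_sum_add_mset image_subset_iff)
  with insert show ?case using assms(1) by (simp add: nat_pow_mult)
qed

lemma (in comm_group) zero_sum_pow_iff:
  assumes "g \<in> carrier G" "finite A"
  shows "zero_sum G {# g [^] y i. i \<in># mset_set A #} \<longleftrightarrow> ord g dvd (sum y A :: nat)"
  using assms by (auto simp: zero_sum_def seq_sum_pow pow_eq_id)

text \<open>Different indices may carry equal terms, so a subsequence can come from several index
  sets; one is enough.\<close>

lemma subseteq_image_mset_set:
  assumes "finite A" "T \<subseteq># image_mset f (mset_set A)"
  obtains B where "B \<subseteq> A" "T = image_mset f (mset_set B)"
proof -
  from assms(2) obtain U where "image_mset f (mset_set A) = T + U"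
    by (auto simp: subset_mset.le_iff_add)
  then obtain T' U' where T': "mset_set A = T' + U'" "T = image_mset f T'"
    by (blast dest: image_mset_eq_plusD)
  have le: "count T' i \<le> count (mset_set A) i" for i
    using T'(1) by simp
  \<comment> \<open>\<open>T'\<close> is part of \<open>mset_set A\<close>, whose counts are at most
    1.\<close>
  have "T' = mset_set (set_mset T')"
  proof (rule multiset_eqI)
    fix i
    show "count T' i = count (mset_set (set_mset T')) i"
      using le[of i] assms(1) by (cases "i \<in> A"; cases "i \<in># T'") (auto simp: le_Suc_eq count_eq_zero_iff)
  qed
  moreover have "set_mset T' \<subseteq> A"
    using T'(1) assms(1) by (metis finite_set_mset_mset_set set_mset_union Un_upper1)
  ultimately show thesis using that T'(2) by metis
qed

text \<open>The bridge to integers: subsequences become index sets, and sums in \<open>G\<close>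
  become exponents modulo \<open>ord g\<close>.\<close>

lemma (in comm_group) minimal_zero_sum_pow_iff:
  assumes g: "g \<in> carrier G" and A: "finite A"
  shows "minimal_zero_sum G {# g [^] y i. i \<in># mset_set A #} \<longleftrightarrow>
    ord g dvd (sum y A :: nat) \<and> (\<forall>B. B \<subset> A \<and> B \<noteq> {} \<longrightarrow> \<not> ord g dvd sum y B)"
proof -
  let ?S = "\<lambda>B. {# g [^] y i. i \<in># mset_set B #}"
  have zs: "zero_sum G (?S B) \<longleftrightarrow> ord g dvd sum y B" if "B \<subseteq> A" for B
    using zero_sum_pow_iff[OF g] finite_subset[OF that A] .
  have "(\<exists>T. T \<subset># ?S A \<and> T \<noteq> {#} \<and> zero_sum G T) \<longleftrightarrow>
      (\<exists>B. B \<subset> A \<and> B \<noteq> {} \<and> ord g dvd sum y B)"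
  proof
    assume "\<exists>T. T \<subset># ?S A \<and> T \<noteq> {#} \<and> zero_sum G T"
    then obtain T where T: "T \<subset># ?S A" "T \<noteq> {#}" "zero_sum G T" by blast
    from T(1) obtain B where B: "B \<subseteq> A" "T = ?S B"
      using subseteq_image_mset_set[OF A] by (metis subset_mset.less_imp_le)
    with T show "\<exists>B. B \<subset> A \<and> B \<noteq> {} \<and> ord g dvd sum y B"
      using zs[OF B(1)] by (intro exI[of _ B]) auto
  next
    assume "\<exists>B. B \<subset> A \<and> B \<noteq> {} \<and> ord g dvd sum y B"
    then obtain B where B: "B \<subset> A" "B \<noteq> {}" "ord g dvd sum y B" by blast
    have fin: "finite B" using B(1) A finite_subset by blast
    have "mset_set B \<subset># mset_set A"
      using B(1) A fin by (auto simp: subset_mset.less_le_not_le)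
    then have "?S B \<subset># ?S A" by (rule image_mset_subset_mono)
    moreover have "?S B \<noteq> {#}"
      using B(2) fin by (simp add: mset_set_empty_iff)
    ultimately show "\<exists>T. T \<subset># ?S A \<and> T \<noteq> {#} \<and> zero_sum G T"
      using B zs[of B] by blast
  qed
  then show ?thesis
    using zs[of A] by (auto simp: minimal_zero_sum_def)
qed

section \<open>Subset sums and the Fano plane\<close>

lemma sum_subset3:
  fixes x :: "nat \<Rightarrow> nat"
  assumes "A \<subseteq> {1,2,3}"
  shows "sum x A = (if 1 \<in> A then x 1 else 0) + (if 2 \<in> A then x 2 else 0) + (if 3 \<in> A then x 3 else 0)"
proof -
  have "sum x A = (\<Sum>i\<in>{1,2,3}. if i \<in> A then x i else 0)"
    using assms by (simp add: sum.inter_restrict[symmetric] Int_absorb1)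
  then show ?thesis by simp
qed

lemma subset3_eq_iff:
  assumes "A \<subseteq> {1,2,3::nat}" "B \<subseteq> {1,2,3}"
  shows "A = B \<longleftrightarrow> (1 \<in> A \<longleftrightarrow> 1 \<in> B) \<and> (2 \<in> A \<longleftrightarrow> 2 \<in> B) \<and> (3 \<in> A \<longleftrightarrow> 3 \<in> B)"
  using assms by blast

lemma sym_diff_subset: "A \<subseteq> C \<Longrightarrow> B \<subseteq> C \<Longrightarrow> sym_diff A B \<subseteq> C"
  by blast

text \<open>
  The proper nonempty subsets of \<open>{1..4}\<close> modulo complements, each represented by its member that
  omits 4. These are the points of the Fano plane, with lines \<open>{A, B, sym_diff A B}\<close>.
\<close>

definition points :: "nat set set" where
  "points = Pow {1,2,3} - {{}}"

lemma points_subset: "A \<in> points \<Longrightarrow> A \<subseteq> {1,2,3}"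
  by (simp add: points_def)

lemma points_iff: "A \<in> points \<longleftrightarrow> A \<subseteq> {1,2,3} \<and> (1 \<in> A \<or> 2 \<in> A \<or> 3 \<in> A)"
  by (auto simp: points_def)

text \<open>
  Three noncollinear 0/1 vectors in dimension 3 have determinant 1 or -1, so the three sums
  generate all of \<open>x\<^sub>1, x\<^sub>2, x\<^sub>3\<close>. The only line with independent sums is
  \<open>{1,2}, {1,3}, {2,3}\<close>, of determinant 2 or -2.
\<close>

lemma dvd_of_noncollinear:
  fixes x :: "nat \<Rightarrow> nat"
  assumes pts: "A \<in> points" "B \<in> points" "C \<in> points"
    and ne: "A \<noteq> B" "A \<noteq> C" "B \<noteq> C" "C \<noteq> sym_diff A B"
    and dvd: "d dvd sum x A" "d dvd sum x B" "d dvd sum x C"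
  shows "d dvd x 1 \<and> d dvd x 2 \<and> d dvd x 3"
proof -
  note sub = pts[THEN points_subset]
  let ?d1 = "d dvd x 1" and ?d2 = "d dvd x 2" and ?d3 = "d dvd x 3"
    and ?d12 = "d dvd x 1 + x 2" and ?d13 = "d dvd x 1 + x 3" and ?d23 = "d dvd x 2 + x 3"
    and ?d123 = "d dvd x 1 + x 2 + x 3"
  have dvd_iff: "d dvd sum x S \<longleftrightarrow>
      (if 1 \<in> S then if 2 \<in> S then if 3 \<in> S then ?d123 else ?d12 else if 3 \<in> S then ?d13 else ?d1
       else if 2 \<in> S then if 3 \<in> S then ?d23 else ?d2 else 3 \<in> S \<longrightarrow> ?d3)"
    if "S \<subseteq> {1,2,3}" for S
    unfolding sum_subset3[OF that] by auto
  have cancel: "d dvd a + b \<Longrightarrow> d dvd a \<longleftrightarrow> d dvd b" for a b :: nat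
    using dvd_add_right_iff dvd_add_left_iff by blast
  have swap: "x 1 + x 3 + x 2 = x 1 + x 2 + x 3" "x 2 + x 3 + x 1 = x 1 + x 2 + x 3"
    by simp_all
  \<comment> \<open>Divisibility of the seven subset sums is treated as seven propositional atoms.
    These facts link them along the six lines other than \<open>{1,2}, {1,3}, {2,3}\<close>.\<close>
  note closed = cancel[of "x 1" "x 2"] cancel[of "x 1" "x 3"] cancel[of "x 2" "x 3"]
    dvd_add[of d "x 1" "x 2"] dvd_add[of d "x 1" "x 3"] dvd_add[of d "x 2" "x 3"]
    cancel[of "x 1 + x 2" "x 3"] cancel[of "x 1 + x 3" "x 2", unfolded swap]
    cancel[of "x 2 + x 3" "x 1", unfolded swap]
  have "1 \<in> A \<or> 2 \<in> A \<or> 3 \<in> A" "1 \<in> B \<or> 2 \<in> B \<or> 3 \<in> B" "1 \<in> C \<or> 2 \<in> C \<or> 3 \<in> C"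
    using pts by (simp_all add: points_iff)
  moreover have "\<not> ((1 \<in> C \<longleftrightarrow> (1 \<in> A) \<noteq> (1 \<in> B)) \<and> (2 \<in> C \<longleftrightarrow> (2 \<in> A) \<noteq> (2 \<in> B)) \<and>
      (3 \<in> C \<longleftrightarrow> (3 \<in> A) \<noteq> (3 \<in> B)))"
    using ne(4) unfolding subset3_eq_iff[OF sub(3) sym_diff_subset[OF sub(1,2)]] by auto
  ultimately show ?thesis
    using ne(1-3) dvd closed
    unfolding dvd_iff[OF sub(1)] dvd_iff[OF sub(2)] dvd_iff[OF sub(3)]
      subset3_eq_iff[OF sub(1,2)] subset3_eq_iff[OF sub(1,3)] subset3_eq_iff[OF sub(2,3)]
    by argo
qed

text \<open>
  Up to complements in \<open>{1..4}\<close>, which do not affect divisibility when the total sum is divisible,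
  the term \<open>x\<^sub>4\<close> is represented by \<open>{1,2,3}\<close>.
\<close>

definition coord :: "nat \<Rightarrow> nat set" where
  "coord i = (if i = 4 then {1,2,3} else {i})"

section \<open>Parity of points and the even line\<close>

lemma even_card_iff:
  assumes "A \<subseteq> {1,2,3::nat}"
  shows "even (card A) \<longleftrightarrow> ((1 \<in> A) = (2 \<in> A)) = (3 \<notin> A)"
  unfolding card_eq_sum sum_subset3[OF assms] by auto

text \<open>Parity is linear over the field with two elements: the even points form the line
  \<open>{1,2}, {1,3}, {2,3}\<close>, and the odd points are the four values
  \<open>coord i\<close>.\<close>

lemma even_card_sym_diff:
  assumes "A \<subseteq> {1,2,3::nat}" "B \<subseteq> {1,2,3}"
  shows "even (card (sym_diff A B)) \<longleftrightarrow> (even (card A) \<longleftrightarrow> even (card B))"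
  unfolding even_card_iff[OF assms(1)] even_card_iff[OF assms(2)]
    even_card_iff[OF sym_diff_subset[OF assms]] by auto

lemma coord_in_points: "i \<in> {1..4} \<Longrightarrow> coord i \<in> points"
  by (auto simp: coord_def points_iff)

lemma odd_card_coord: "odd (card (coord i))"
  by (simp add: coord_def)

text \<open>Overlapping subsets of \<open>{1,2,3}\<close> that are not nested have two elements
  each. In the first three cases one set on the line through \<open>A\<close> and \<open>B\<close>
  is the disjoint union of the other two.\<close>

lemma sym_diff_cases:
  assumes "A \<in> points" "B \<in> points" "A \<noteq> B"
  obtains "A \<inter> B = {}" | "A \<subseteq> B" | "B \<subseteq> A" | "even (card A)" "even (card B)"
proof -
  note sub = assms(1,2)[THEN points_subset]
  have "A \<inter> B = {} \<longleftrightarrow> \<not> (1 \<in> A \<and> 1 \<in> B) \<and> \<not> (2 \<in> A \<and> 2 \<in> B) \<and> \<not> (3 \<in> A \<and> 3 \<in> B)"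
    "A \<subseteq> B \<longleftrightarrow> (1 \<in> A \<longrightarrow> 1 \<in> B) \<and> (2 \<in> A \<longrightarrow> 2 \<in> B) \<and> (3 \<in> A \<longrightarrow> 3 \<in> B)"
    "B \<subseteq> A \<longleftrightarrow> (1 \<in> B \<longrightarrow> 1 \<in> A) \<and> (2 \<in> B \<longrightarrow> 2 \<in> A) \<and> (3 \<in> B \<longrightarrow> 3 \<in> A)"
    using sub by blast+
  then have "A \<inter> B = {} \<or> A \<subseteq> B \<or> B \<subseteq> A \<or> even (card A) \<and> even (card B)"
    unfolding even_card_iff[OF sub(1)] even_card_iff[OF sub(2)] by argo
  then show thesis using that by blast
qed

text \<open>The parity assumption excludes the even line; on any other line one sum is the sum of
  the other two.\<close>

lemma dvd_sum_sym_diff: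
  fixes x :: "nat \<Rightarrow> nat"
  assumes "A \<in> points" "B \<in> points" "A \<noteq> B" and odd: "odd (card A) \<or> odd (card B)"
    and dvd: "d dvd sum x A" "d dvd sum x B"
  shows "d dvd sum x (sym_diff A B)"
proof -
  have fin: "finite A" "finite B"
    using assms(1,2)[THEN points_subset] finite_subset by blast+
  have *: "d dvd sum x (T - S)" if "S \<subseteq> T" "finite T" "d dvd sum x S" "d dvd sum x T" for S T
    using that sum.subset_diff[of S T x] dvd_add_left_iff by metis
  from assms(1-3) show ?thesis
  proof (cases rule: sym_diff_cases)
    case 1
    then have "sym_diff A B = A \<union> B" by blast
    then show ?thesis using dvd fin 1 by (simp add: sum.union_disjoint)
  next
    case 2
    then have "sym_diff A B = B - A" by blast
    then show ?thesis using *[of A B] dvd fin 2 by simp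
  next
    case 3
    then have "sym_diff A B = A - B" by blast
    then show ?thesis using *[of B A] dvd fin 3 by simp
  qed (use odd in simp)
qed

section \<open>Divisibility and gcds with products of primes\<close>

lemma dvd_of_dvd_coprime_mults:
  fixes a b n s :: nat
  assumes "coprime a b" "n dvd a * s" "n dvd b * s"
  shows "n dvd s"
proof -
  have "n dvd gcd (s * a) (s * b)" using assms(2,3) by (simp add: mult.commute)
  also have "gcd (s * a) (s * b) = s * gcd a b" by (rule gcd_mult_distrib_nat[symmetric])
  finally show ?thesis using assms(1) by simp
qed

lemma gcd_prime:
  fixes p y :: nat
  assumes "Factorial_Ring.prime p"
  shows "gcd y p = (if p dvd y then p else 1)"
  using assms by (metis coprime_iff_gcd_eq_1 gcd.commute gcd_nat.absorb1 prime_imp_coprime)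

lemma gcd_mult_coprime:
  fixes a b y :: nat
  assumes "coprime a b"
  shows "gcd y (a * b) = gcd y a * gcd y b"
proof (rule dvd_antisym)
  obtain c d where cd: "gcd y (a * b) = c * d" "c dvd a" "d dvd b"
    using division_decomp[of "gcd y (a * b)" a b] by auto
  then have "c dvd y" "d dvd y"
    by (metis dvd_mult_left dvd_mult_right gcd_dvd1)+
  with cd show "gcd y (a * b) dvd gcd y a * gcd y b"
    by (simp add: mult_dvd_mono)
next
  have "coprime (gcd y a) (gcd y b)"
    using assms coprime_divisors gcd_dvd2 by blast
  then show "gcd y a * gcd y b dvd gcd y (a * b)"
    by (intro gcd_greatest divides_mult mult_dvd_mono) simp_all
qed

lemma gcd_three_primes:
  fixes p q r y :: nat
  assumes "Factorial_Ring.prime p" "Factorial_Ring.prime q" "Factorial_Ring.prime r"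
    and "p \<noteq> q" "p \<noteq> r" "q \<noteq> r"
  shows "gcd y (p * q * r) =
    (if p dvd y then p else 1) * (if q dvd y then q else 1) * (if r dvd y then r else 1)"
proof -
  have "coprime p q" "coprime (p * q) r"
    using assms primes_coprime by auto
  then show ?thesis
    using assms(1-3) by (simp only: gcd_mult_coprime gcd_prime)
qed

lemma prime_factors_three_prod:
  fixes p q r n :: nat
  assumes "prime_factors n = {p,q,r}" "p \<noteq> q" "p \<noteq> r" "q \<noteq> r" "n > 0"
    and "\<And>t. t \<in> prime_factors n \<Longrightarrow> \<not> t ^ 2 dvd n"
  shows "n = p * q * r"
proof -
  have "multiplicity t n = 1" if "t \<in> prime_factors n" for t
    using in_prime_factors_imp_dvd[OF that] assms(6)[OF that]
    by (intro multiplicity_eqI) (simp_all add: numeral_2_eq_2)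
  then have "(\<Prod>t\<in>prime_factors n. t ^ multiplicity t n) = (\<Prod>t\<in>prime_factors n. t)"
    by (intro prod.cong) auto
  moreover have "(\<Prod>t\<in>prime_factors n. t ^ multiplicity t n) = n"
    using assms(5) using prod_prime_factors[of n] by simp
  ultimately show ?thesis using assms(1-4) by simp
qed

section \<open>Reduced quadruples of integers\<close>

lemma ex_four_distinct:
  assumes "card A > 3"
  obtains a b c d where "{a,b,c,d} \<subseteq> A" "distinct [a,b,c,d]"
proof -
  obtain T where "T \<subseteq> A" "card T = 4"
    using obtain_subset_with_card_n[of 4 A] assms by auto
  moreover from this(2) obtain xs where "set xs = T" "distinct xs" "length xs = 4"
    by (metis card_ge_0_finite distinct_card finite_distinct_list zero_less_numeral)
  ultimately show thesis
    using that by (auto simp: numeral_eq_Suc length_Suc_conv)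
qed

text \<open>The integer form of the problem. \<open>I p\<close> witnesses that multiplication by
  \<open>p\<close> destroys minimality. As \<open>n\<close> divides the total, an index set may be
  traded for its complement, so points suffice.\<close>

locale reduced_quadruple =
  fixes n :: nat and x :: "nat \<Rightarrow> nat" and I :: "nat \<Rightarrow> nat set"
  assumes n_pos: "n > 0"
    and zero_sum: "n dvd sum x {1..4}"
    and minimal: "A \<in> points \<Longrightarrow> \<not> n dvd sum x A"
    and primitive: "Gcd (insert n (x ` {1..4})) = 1"
    and I_points: "p \<in> prime_factors n \<Longrightarrow> I p \<in> points"
    and I_dvd: "p \<in> prime_factors n \<Longrightarrow> n dvd p * sum x (I p)"
begin

lemma dvd_coord_iff:
  assumes "p dvd n" "i \<in> {1..4}"
  shows "p dvd x i \<longleftrightarrow> p dvd sum x (coord i)"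
proof (cases "i = 4")
  case True
  have "sum x {1..4} = sum x {1,2,3} + x 4"
    by (simp add: numeral_eq_Suc)
  with assms(1) zero_sum have "p dvd sum x {1,2,3} + x 4" by (metis dvd_trans)
  then have "p dvd x 4 \<longleftrightarrow> p dvd sum x {1,2,3}"
    using dvd_add_right_iff dvd_add_left_iff by blast
  with True show ?thesis by (simp add: coord_def)
qed (simp add: coord_def)

text \<open>The zero sum would carry divisibility over to the fourth term, and \<open>p\<close>
  would divide the full gcd.\<close>

lemma not_dvd_all:
  assumes "p \<in> prime_factors n"
  shows "\<not> (p dvd x 1 \<and> p dvd x 2 \<and> p dvd x 3)"
proof
  assume *: "p dvd x 1 \<and> p dvd x 2 \<and> p dvd x 3"
  then have "p dvd sum x (coord 4)" by (simp add: coord_def)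
  then have "p dvd x 4" using dvd_coord_iff[of p 4] assms by auto
  moreover have "{1..4} = {1,2,3,4::nat}" by auto
  ultimately have "p dvd Gcd (insert n (x ` {1..4}))"
    using * assms by (intro Gcd_greatest) auto
  with primitive assms show False
    by (metis in_prime_factors_imp_prime not_prime_unit)
qed

lemma dvd_sum_I:
  assumes "p \<in> prime_factors n" "q \<in> prime_factors n" "p \<noteq> q"
  shows "p dvd sum x (I q)"
proof -
  have "p dvd q * sum x (I q)" using I_dvd[OF assms(2)] assms(1) by (meson dvd_trans in_prime_factors_imp_dvd)
  moreover have "\<not> p dvd q" using assms primes_dvd_imp_eq by blast
  ultimately show ?thesis using assms(1) prime_dvd_multD in_prime_factors_imp_prime by blast
qed

text \<open>At a common point the coprime factors \<open>p\<close> and \<open>q\<close> could be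
  cancelled, against minimality.\<close>

lemma I_distinct:
  assumes "p \<in> prime_factors n" "q \<in> prime_factors n" "p \<noteq> q"
  shows "I p \<noteq> I q"
proof
  assume "I p = I q"
  then have "n dvd p * sum x (I p)" "n dvd q * sum x (I p)"
    using I_dvd assms by metis+
  moreover have "coprime p q" using assms by (auto intro: primes_coprime)
  ultimately have "n dvd sum x (I p)"
    using dvd_of_dvd_coprime_mults by blast
  with minimal I_points assms(1) show False by blast
qed

text \<open>In other words, the points whose sums are divisible by \<open>p\<close> lie on one
  line.\<close>

lemma dvd_noncollinear_False:
  assumes "p \<in> prime_factors n" "A \<in> points" "B \<in> points" "C \<in> points"
    and "A \<noteq> B" "A \<noteq> C" "B \<noteq> C" "C \<noteq> sym_diff A B"
    and "p dvd sum x A" "p dvd sum x B" "p dvd sum x C"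
  shows False
  using dvd_of_noncollinear[OF assms(2-11)] not_dvd_all[OF assms(1)] by blast

lemma I_collinear:
  assumes "{p,q,r,t} \<subseteq> prime_factors n" "distinct [p,q,r,t]"
  shows "I t = sym_diff (I q) (I r)"
  using dvd_noncollinear_False[of p "I q" "I r" "I t"] assms
    dvd_sum_I[of p] I_points I_distinct by auto

text \<open>Two lines of the Fano plane that share two points coincide.\<close>

lemma card_prime_factors_le: "card (prime_factors n) \<le> 3"
proof (rule ccontr)
  assume "\<not> ?thesis"
  then obtain p q r t where *: "{p,q,r,t} \<subseteq> prime_factors n" "distinct [p,q,r,t]"
    using ex_four_distinct[of "prime_factors n"] by (metis not_le)
  then have "I t = sym_diff (I q) (I r)" "I t = sym_diff (I p) (I r)"
    using I_collinear[of p q r t] I_collinear[of q p r t] by auto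
  then have "I p = I q" by blast
  then show False using I_distinct[of p q] * by auto
qed

text \<open>Since the third sum is the sum of the other two, \<open>n\<close> divides it after
  multiplication by \<open>p * q\<close> and also by \<open>r\<close>; coprimality then contradicts
  minimality.\<close>

lemma disjoint_line_False:
  assumes "{p,q,r} \<subseteq> prime_factors n" "distinct [p,q,r]"
    and "I r = I p \<union> I q" "I p \<inter> I q = {}"
  shows False
proof -
  have "finite (I p)" "finite (I q)"
    using assms(1) I_points points_subset finite_subset by (metis finite.simps insert_subset)+
  then have "(p * q) * sum x (I r) = q * (p * sum x (I p)) + p * (q * sum x (I q))"
    using assms(3,4) by (simp add: sum.union_disjoint algebra_simps)
  moreover have "n dvd q * (p * sum x (I p)) + p * (q * sum x (I q))"
    using assms(1) I_dvd by simp
  ultimately have "n dvd (p * q) * sum x (I r)" by simp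
  moreover have "n dvd r * sum x (I r)" using assms(1) I_dvd by simp
  moreover have "coprime (p * q) r" using assms by (auto intro: primes_coprime)
  ultimately have "n dvd sum x (I r)"
    using dvd_of_dvd_coprime_mults by blast
  with minimal I_points assms(1) show False by auto
qed

text \<open>On any line but the even one, some set is the disjoint union of the other two, which is
  excluded whichever prime it belongs to.\<close>

lemma collinear_imp_even:
  assumes "{p,q,r} \<subseteq> prime_factors n" "distinct [p,q,r]"
    and "I r = sym_diff (I p) (I q)"
  shows "even (card (I p)) \<and> even (card (I q)) \<and> even (card (I r))"
proof -
  have pts: "I p \<in> points" "I q \<in> points" "I p \<noteq> I q"
    using assms(1,2) I_points I_distinct by auto
  then show ?thesis
  proof (cases rule: sym_diff_cases)
    case 1
    then have "I r = I p \<union> I q" using assms(3) by blast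
    then show ?thesis using disjoint_line_False[of p q r] assms(1,2) 1 by blast
  next
    case 2
    then have "I q = I p \<union> I r" "I p \<inter> I r = {}" using assms(3) by blast+
    then show ?thesis using disjoint_line_False[of p r q] assms(1,2) by auto
  next
    case 3
    then have "I p = I q \<union> I r" "I q \<inter> I r = {}" using assms(3) by blast+
    then show ?thesis using disjoint_line_False[of q r p] assms(1,2) by auto
  next
    case 4
    then show ?thesis
      using assms(3) even_card_sym_diff pts points_subset by simp
  qed
qed

lemma dvd_coord_imp:
  assumes "{p,q,r} \<subseteq> prime_factors n" "distinct [p,q,r]" "i \<in> {1..4}" "p dvd x i"
  shows "coord i \<in> {I q, I r, sym_diff (I q) (I r)}"
proof (rule ccontr)
  assume *: "\<not> ?thesis"
  have "p dvd sum x (coord i)" using dvd_coord_iff[of p i] assms by auto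
  then show False
    using * dvd_noncollinear_False[of p "I q" "I r" "coord i"] assms(1-3) coord_in_points[of i]
      dvd_sum_I[of p] I_points I_distinct by auto
qed

text \<open>A common prime of \<open>x i\<close> and \<open>n\<close> would put the odd point
  \<open>coord i\<close> on a line through two even points, but such a line has only even
  points.\<close>

lemma coprime_of_even:
  assumes P: "prime_factors n = {p,q,r}" "distinct [p,q,r]"
    and even: "even (card (I p))" "even (card (I q))" "even (card (I r))"
    and i: "i \<in> {1..4}"
  shows "gcd (x i) n = 1"
proof (rule ccontr)
  assume "gcd (x i) n \<noteq> 1"
  then obtain t where t: "Factorial_Ring.prime t" "t dvd x i" "t dvd n"
    by (metis gcd_nat.bounded_iff prime_factor_nat)
  have ev: "even (card (sym_diff (I a) (I b)))" if "a \<in> {p,q,r}" "b \<in> {p,q,r}" for a b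
    using that even even_card_sym_diff[of "I a" "I b"] I_points points_subset P(1) by auto
  have "t \<in> {p,q,r}" using t n_pos P(1) by (auto simp: prime_factors_dvd)
  then have "t = p \<or> t = q \<or> t = r" by simp
  then obtain a b where ab: "a \<in> {p,q,r}" "b \<in> {p,q,r}"
    "coord i \<in> {I a, I b, sym_diff (I a) (I b)}"
  proof (elim disjE)
    assume "t = p" then show thesis using dvd_coord_imp[of p q r i] P i t that[of q r] by auto
  next
    assume "t = q" then show thesis using dvd_coord_imp[of q p r i] P i t that[of p r] by auto
  next
    assume "t = r" then show thesis using dvd_coord_imp[of r p q i] P i t that[of p q] by auto
  qed
  then have "even (card (coord i))" using ev[of a b] even by auto
  with odd_card_coord show False by blast
qed

text \<open>For the converse, if \<open>coord i\<close> is the third point of the line, its oddness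
  shows that \<open>I q\<close> and \<open>I r\<close> are not both even, so divisibility passes to
  it.\<close>

lemma dvd_x_iff:
  assumes "{p,q,r} \<subseteq> prime_factors n" "distinct [p,q,r]" "i \<in> {1..4}"
  shows "p dvd x i \<longleftrightarrow> coord i \<in> {I q, I r, sym_diff (I q) (I r)}"
proof
  assume *: "coord i \<in> {I q, I r, sym_diff (I q) (I r)}"
  have pts: "I q \<in> points" "I r \<in> points" "I q \<noteq> I r"
    using assms I_points I_distinct by auto
  have dvd: "p dvd sum x (I q)" "p dvd sum x (I r)"
    using assms dvd_sum_I by auto
  have "p dvd sum x (sym_diff (I q) (I r))" if "coord i = sym_diff (I q) (I r)"
  proof (rule dvd_sum_sym_diff[OF pts _ dvd])
    show "odd (card (I q)) \<or> odd (card (I r))"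
      using odd_card_coord[of i] that even_card_sym_diff pts points_subset by metis
  qed
  then have "p dvd sum x (coord i)" using * dvd by auto
  then show "p dvd x i" using dvd_coord_iff[of p i] assms by auto
qed (rule dvd_coord_imp[OF assms])

text \<open>Cancelling one \<open>t\<close> in \<open>I_dvd\<close> would make \<open>t\<close>
  divide its own sum too, hence the sums at three noncollinear points.\<close>

lemma not_square_dvd:
  assumes "prime_factors n = {p,q,r}" "distinct [p,q,r]" "I r \<noteq> sym_diff (I p) (I q)"
    and t: "t \<in> prime_factors n"
  shows "\<not> t ^ 2 dvd n"
proof
  assume sq: "t ^ 2 dvd n"
  have "t dvd sum x (I s)" if s: "s \<in> prime_factors n" for s
  proof (cases "s = t")
    case True
    have "t ^ 2 dvd t * sum x (I t)" using dvd_trans[OF sq I_dvd[OF t]] .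
    moreover have "t \<noteq> 0" using t by (metis in_prime_factors_imp_prime not_prime_0)
    ultimately show ?thesis using True by (simp add: power2_eq_square)
  qed (simp add: dvd_sum_I[OF t s])
  then show False
    using dvd_noncollinear_False[OF t, of "I p" "I q" "I r"] assms I_points I_distinct by auto
qed

lemma gcd_eq:
  assumes P: "prime_factors n = {p,q,r}" "distinct [p,q,r]"
    and ncol: "I r \<noteq> sym_diff (I p) (I q)" and i: "i \<in> {1..4}"
  shows "gcd (x i) n =
    (if coord i \<in> {I q, I r, sym_diff (I q) (I r)} then p else 1) *
    (if coord i \<in> {I p, I r, sym_diff (I p) (I r)} then q else 1) *
    (if coord i \<in> {I p, I q, sym_diff (I p) (I q)} then r else 1)"
proof -
  have n: "n = p * q * r"
    using prime_factors_three_prod[OF P(1) _ _ _ n_pos not_square_dvd[OF P ncol]] P(2) by simp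
  have primes: "Factorial_Ring.prime p" "Factorial_Ring.prime q" "Factorial_Ring.prime r"
    using in_prime_factors_imp_prime[of _ n] P(1) by blast+
  have dvd_iff: "p dvd x i \<longleftrightarrow> coord i \<in> {I q, I r, sym_diff (I q) (I r)}"
    "q dvd x i \<longleftrightarrow> coord i \<in> {I p, I r, sym_diff (I p) (I r)}"
    "r dvd x i \<longleftrightarrow> coord i \<in> {I p, I q, sym_diff (I p) (I q)}"
    using P by (intro dvd_x_iff i; auto)+
  have "p \<noteq> q" "p \<noteq> r" "q \<noteq> r" using P(2) by simp_all
  from gcd_three_primes[OF primes this, of "x i"] show ?thesis
    unfolding dvd_iff n[symmetric] .
qed

end

section \<open>Gcd patterns by the number of even points\<close>

lemma coord_eq_iff:
  assumes "i \<in> {1..4}" "S \<subseteq> {1,2,3}"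
  shows "coord i = S \<longleftrightarrow>
    (1 \<in> S \<longleftrightarrow> i = 1 \<or> i = 4) \<and> (2 \<in> S \<longleftrightarrow> i = 2 \<or> i = 4) \<and> (3 \<in> S \<longleftrightarrow> i = 3 \<or> i = 4)"
  unfolding subset3_eq_iff[OF points_subset[OF coord_in_points[OF assms(1)]] assms(2)]
  using assms(1) by (auto simp: coord_def)

lemma even_point_cases:
  assumes "A \<in> points" "even (card A)"
  obtains "A = {1,2}" | "A = {1,3}" | "A = {2,3}"
proof -
  have "A \<subseteq> {1,2,3}" using assms(1) by (rule points_subset)
  with assms have "A = {1,2} \<or> A = {1,3} \<or> A = {2,3}"
    by (auto simp: points_iff even_card_iff subset3_eq_iff[of A])
  then show thesis using that by blast
qed

lemma odd_point_cases:
  assumes "A \<in> points" "odd (card A)"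
  obtains "A = {1}" | "A = {2}" | "A = {3}" | "A = {1,2,3}"
proof -
  have "A \<subseteq> {1,2,3}" using assms(1) by (rule points_subset)
  with assms have "A = {1} \<or> A = {2} \<or> A = {3} \<or> A = {1,2,3}"
    by (auto simp: points_iff even_card_iff subset3_eq_iff[of A])
  then show thesis using that by blast
qed

context
  fixes A B C :: "nat set" and p q r :: nat and F :: "nat \<Rightarrow> nat"
  assumes pts: "A \<in> points" "B \<in> points" "C \<in> points"
    and ne: "A \<noteq> B" "A \<noteq> C" "B \<noteq> C" "C \<noteq> sym_diff A B"
    and F: "\<And>i. i \<in> {1..4} \<Longrightarrow> F i =
      (if coord i \<in> {B, C, sym_diff B C} then p else 1) *
      (if coord i \<in> {A, C, sym_diff A C} then q else 1) *
      (if coord i \<in> {A, B, sym_diff A B} then r else 1)"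
begin

text \<open>The odd points are \<open>B\<close>, \<open>C\<close>, \<open>sym_diff A B\<close>,
  \<open>sym_diff A C\<close>, with values \<open>p * r\<close>, \<open>p * q\<close>,
  \<open>r\<close>, \<open>q\<close> in this order.\<close>

lemma F_mset_one_even:
  assumes "even (card A)" "odd (card B)" "odd (card C)"
  shows "{#F 1, F 2, F 3, F 4#} = {#p * q, q, p * r, r#}"
  using pts(1) assms(1)
  \<comment> \<open>Both sides are computed for each concrete triple of points; \<open>ne\<close>
    discards the degenerate triples.\<close>
  by (cases rule: even_point_cases; cases rule: odd_point_cases[OF pts(2) assms(2)];
      cases rule: odd_point_cases[OF pts(3) assms(3)])
    (use ne in \<open>simp_all add: F coord_eq_iff insert_Diff_if insert_commute ac_simps add_mset_commute\<close>)

text \<open>The odd points \<open>C\<close>, \<open>sym_diff B C\<close>,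
  \<open>sym_diff A C\<close> have values \<open>p * q\<close>, \<open>p\<close>, \<open>q\<close>,
  and the fourth has 1. The factor \<open>r\<close> never occurs, as the line through
  \<open>A\<close> and \<open>B\<close> is even.\<close>

lemma F_mset_two_even:
  assumes "even (card A)" "even (card B)" "odd (card C)"
  shows "{#F 1, F 2, F 3, F 4#} = {#1, p, q, p * q#}"
  using pts(1) assms(1)
  by (cases rule: even_point_cases; cases rule: even_point_cases[OF pts(2) assms(2)];
      cases rule: odd_point_cases[OF pts(3) assms(3)])
    (use ne in \<open>simp_all add: F coord_eq_iff insert_Diff_if insert_commute ac_simps add_mset_commute\<close>)

text \<open>Each of \<open>A\<close>, \<open>B\<close>, \<open>C\<close> lies on the lines of two
  primes, the fourth odd point on none.\<close>

lemma F_mset_all_odd: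
  assumes "odd (card A)" "odd (card B)" "odd (card C)"
  shows "{#F 1, F 2, F 3, F 4#} = {#1, p * q, p * r, q * r#}"
  using pts(1) assms(1)
  by (cases rule: odd_point_cases; cases rule: odd_point_cases[OF pts(2) assms(2)];
      cases rule: odd_point_cases[OF pts(3) assms(3)])
    (use ne in \<open>simp_all add: F coord_eq_iff insert_Diff_if insert_commute ac_simps add_mset_commute\<close>)

end

lemma image_mset_atLeastAtMost_4:
  "image_mset f (mset_set {1..4::nat}) = {#f 1, f 2, f 3, f 4#}"
proof -
  have "{1..4} = {1,2,3,4::nat}" by auto
  then show ?thesis by simp
qed

text \<open>Supplies the renumbering for the pattern that names the terms individually.\<close>

lemma ex_permutation_of_image_mset:
  assumes "image_mset f (mset_set {1..4::nat}) = {#a, b, c, d#}"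
  shows "\<exists>\<sigma>. \<sigma> permutes {1..4} \<and> f (\<sigma> 1) = a \<and> f (\<sigma> 2) = b \<and> f (\<sigma> 3) = c \<and> f (\<sigma> 4) = d"
proof -
  define h where "h i = (if i = 1 then a else if i = 2 then b else if i = 3 then c else d)" for i :: nat
  have h: "h 1 = a" "h 2 = b" "h 3 = c" "h 4 = d" by (simp_all add: h_def)
  have "image_mset h (mset_set {1..4}) = image_mset f (mset_set {1..4})"
    unfolding assms by (simp only: image_mset_atLeastAtMost_4 h)
  then obtain \<sigma> where \<sigma>: "\<sigma> permutes {1..4}" "\<forall>i\<in>{1..4}. h i = f (\<sigma> i)"
    by (rule image_mset_eq_implies_permutes[OF finite_atLeastAtMost])
  have "f (\<sigma> i) = h i" if "i \<in> {1..4}" for i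
    using bspec[OF \<sigma>(2) that] by (rule sym)
  from \<sigma>(1) this[of 1] this[of 2] this[of 3] this[of 4] show ?thesis
    unfolding h by (intro exI[of _ \<sigma>]) simp
qed

section \<open>Labelling the primes by parity\<close>

context reduced_quadruple
begin

abbreviation gcd_mset :: "nat multiset" where
  "gcd_mset \<equiv> {#gcd (x i) n. i \<in># mset_set {1..4}#}"

text \<open>With the primes of even points listed first, the number of even points selects the
  pattern.\<close>

lemma gcd_mset_cases_sorted:
  assumes P: "prime_factors n = {p,q,r}" "distinct [p,q,r]"
    and ncol: "I r \<noteq> sym_diff (I p) (I q)"
    and sorted: "even (card (I q)) \<Longrightarrow> even (card (I p))" "even (card (I r)) \<Longrightarrow> even (card (I q))"
  shows "gcd_mset = {#p * q, q, p * r, r#} \<or> gcd_mset = {#1, p, q, p * q#} \<or>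
    (\<forall>i\<in>{1..4}. gcd (x i) n = 1) \<or> gcd_mset = {#1, p * q, p * r, q * r#}"
proof -
  have pts: "I p \<in> points" "I q \<in> points" "I r \<in> points"
    using I_points P(1) by auto
  have ne: "I p \<noteq> I q" "I p \<noteq> I r" "I q \<noteq> I r"
    using I_distinct P by auto
  consider "even (card (I r))" | "even (card (I q))" "odd (card (I r))"
    | "even (card (I p))" "odd (card (I q))" "odd (card (I r))"
    | "odd (card (I p))" "odd (card (I q))" "odd (card (I r))"
    using sorted by blast
  then show ?thesis
  proof cases
    \<comment> \<open>Three distinct even points form a line, so \<open>ncol\<close> rules this case
      out; coprimality settles it directly.\<close>
    case 1
    then have "even (card (I p)) \<and> even (card (I q))" using sorted by simp
    with 1 have "\<forall>i\<in>{1..4}. gcd (x i) n = 1" using coprime_of_even[OF P] by simp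
    then show ?thesis by (intro disjI2 disjI1)
  next
    case 2
    have "gcd_mset = {#1, p, q, p * q#}"
      unfolding image_mset_atLeastAtMost_4
      by (rule F_mset_two_even[OF pts ne ncol gcd_eq[OF P ncol]]) (use 2 sorted(1) in simp_all)
    then show ?thesis by blast
  next
    case 3
    have "gcd_mset = {#p * q, q, p * r, r#}"
      unfolding image_mset_atLeastAtMost_4
      by (rule F_mset_one_even[OF pts ne ncol gcd_eq[OF P ncol]]) (use 3 in simp_all)
    then show ?thesis by blast
  next
    case 4
    have "gcd_mset = {#1, p * q, p * r, q * r#}"
      unfolding image_mset_atLeastAtMost_4
      by (rule F_mset_all_odd[OF pts ne ncol gcd_eq[OF P ncol]]) (use 4 in simp_all)
    then show ?thesis by blast
  qed
qed

lemma gcd_mset_cases: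
  assumes "card (prime_factors n) = 3"
  shows "\<exists>p q r. prime_factors n = {p,q,r} \<and>
    (gcd_mset = {#p * q, q, p * r, r#} \<or> gcd_mset = {#1, p, q, p * q#} \<or>
     (\<forall>i\<in>{1..4}. gcd (x i) n = 1) \<or> gcd_mset = {#1, p * q, p * r, q * r#})"
proof -
  obtain p q r where P: "prime_factors n = {p,q,r}" "distinct [p,q,r]"
    using assms unfolding card_3_iff by (metis distinct_length_2_or_more distinct_singleton)
  show ?thesis
  proof (cases "I r = sym_diff (I p) (I q)")
    case True
    have "even (card (I p)) \<and> even (card (I q)) \<and> even (card (I r))"
      by (rule collinear_imp_even[OF _ P(2) True]) (simp add: P(1))
    then have "\<forall>i\<in>{1..4}. gcd (x i) n = 1"
      using coprime_of_even[OF P] by simp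
    with P(1) show ?thesis by (intro exI[of _ p] exI[of _ q] exI[of _ r]) simp
  next
    case False
    have sorted: ?thesis if "{a,b,c} = {p,q,r}" "distinct [a,b,c]" "I c \<noteq> sym_diff (I a) (I b)"
      "even (card (I b)) \<Longrightarrow> even (card (I a))" "even (card (I c)) \<Longrightarrow> even (card (I b))" for a b c
    proof -
      have P': "prime_factors n = {a,b,c}" using that(1) P(1) by simp
      from gcd_mset_cases_sorted[OF P' that(2-5)] show ?thesis
        by (intro exI[of _ a] exI[of _ b] exI[of _ c] conjI P')
    qed
    have perms: "{q,p,r} = {p,q,r}" "{p,r,q} = {p,q,r}" "{q,r,p} = {p,q,r}" "{r,p,q} = {p,q,r}"
      "{r,q,p} = {p,q,r}"
      by (simp_all add: insert_commute)
    have ncol: "I r \<noteq> sym_diff (I q) (I p)" "I q \<noteq> sym_diff (I p) (I r)" "I q \<noteq> sym_diff (I r) (I p)"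
      "I p \<noteq> sym_diff (I q) (I r)" "I p \<noteq> sym_diff (I r) (I q)"
      using False by (auto simp: set_eq_iff)
    have dist: "distinct [q,p,r]" "distinct [p,r,q]" "distinct [q,r,p]" "distinct [r,p,q]"
      "distinct [r,q,p]"
      using P(2) by auto
    \<comment> \<open>Comparing parities is a total preorder, so at least one of the six orders of
      \<open>p\<close>, \<open>q\<close>, \<open>r\<close> is sorted.\<close>
    let ?le = "\<lambda>a b. even (card (I b)) \<longrightarrow> even (card (I a))"
    consider "?le p q" "?le q r" | "?le q p" "?le p r" | "?le p r" "?le r q"
      | "?le q r" "?le r p" | "?le r p" "?le p q" | "?le r q" "?le q p"
      by argo
    then show ?thesis
    proof cases
      case 1
      then show ?thesis by (intro sorted[OF refl P(2) False]) simp_all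
    next
      case 2
      then show ?thesis by (intro sorted[OF perms(1) dist(1) ncol(1)]) simp_all
    next
      case 3
      then show ?thesis by (intro sorted[OF perms(2) dist(2) ncol(2)]) simp_all
    next
      case 4
      then show ?thesis by (intro sorted[OF perms(3) dist(3) ncol(4)]) simp_all
    next
      case 5
      then show ?thesis by (intro sorted[OF perms(4) dist(4) ncol(3)]) simp_all
    next
      case 6
      then show ?thesis by (intro sorted[OF perms(5) dist(5) ncol(5)]) simp_all
    qed
  qed
qed

end

section \<open>Transfer to the cyclic group\<close>

theorem theorem2p1:
  fixes G :: "'a monoid" and g :: 'a and n :: nat
    and x :: "nat \<Rightarrow> nat" and S :: "'a multiset"
  assumes "group G" and "cyclic_group G" and "order G = n" and "n > 1000"
    and "g \<in> carrier G" and "group.ord G g = n"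
    and "\<forall>i\<in>{1..4}. 1 \<le> x i \<and> x i \<le> n - 1"
    and "S = {# g [^]\<^bsub>G\<^esub> x i. i \<in># mset_set {1..4} #}"
    and "minimal_zero_sum G S"
    and "reduced_seq G S"
    and "Gcd (insert n (x ` {1..4})) = 1"
  shows "card (prime_factors n) \<le> 3 \<and>
    (card (prime_factors n) = 3 \<longrightarrow>
      (\<exists>\<sigma> p1 p2 p3. \<sigma> permutes {1..4} \<and> prime_factors n = {p1, p2, p3} \<and>
        (image_mset (\<lambda>i. gcd (x i) n) (mset_set {1..4}) = {# p1 * p2, p2, p1 * p3, p3 #} \<or>
         image_mset (\<lambda>i. gcd (x i) n) (mset_set {1..4}) = {# 1, p1, p2, p1 * p2 #} \<or>
         (\<forall>i\<in>{1..4}. gcd (x i) n = 1) \<or>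
         (gcd (x (\<sigma> 1)) n = 1 \<and> gcd (x (\<sigma> 2)) n = p1 * p2 \<and>
          gcd (x (\<sigma> 3)) n = p1 * p3 \<and> gcd (x (\<sigma> 4)) n = p2 * p3))))"
proof -
  interpret comm_group G
    using assms(1,2) by (rule group.cyclic_imp_abelian_group)
  \<comment> \<open>Arbitrary exponents \<open>y\<close> cover both \<open>x i\<close> and
    \<open>p * x i\<close>.\<close>
  have min_iff: "minimal_zero_sum G {# g [^]\<^bsub>G\<^esub> y i. i \<in># mset_set {1..4} #} \<longleftrightarrow>
    n dvd sum y {1..4} \<and> (\<forall>B. B \<subset> {1..4} \<and> B \<noteq> {} \<longrightarrow> \<not> n dvd sum y B)"
    for y :: "nat \<Rightarrow> nat"
    using minimal_zero_sum_pow_iff[OF assms(5), of "{1..4}" y] assms(6) by simp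
  from assms(9) have "n dvd sum x {1..4} \<and> (\<forall>B. B \<subset> {1..4} \<and> B \<noteq> {} \<longrightarrow> \<not> n dvd sum x B)"
    unfolding assms(8) min_iff .
  then have zs: "n dvd sum x {1..4}"
    and min: "B \<subset> {1..4} \<Longrightarrow> B \<noteq> {} \<Longrightarrow> \<not> n dvd sum x B" for B
    by simp_all
  have points_psubset: "B \<subset> {1..4}" "B \<noteq> {}" if "B \<in> points" for B
  proof -
    from that have "B \<subseteq> {1,2,3}" "B \<noteq> {}" by (auto simp: points_def)
    moreover have "{1,2,3} \<subseteq> {1..4::nat}" "4 \<notin> {1,2,3::nat}" "4 \<in> {1..4::nat}" by auto
    ultimately show "B \<subset> {1..4}" "B \<noteq> {}" by blast+
  qed
  have "\<exists>J. J \<in> points \<and> n dvd p * sum x J" if p: "p \<in> prime_factors n" for p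
  proof -
    have "{# h [^]\<^bsub>G\<^esub> p. h \<in># S #} = {# g [^]\<^bsub>G\<^esub> (p * x i). i \<in># mset_set {1..4} #}"
      using assms(5,8) by (simp add: image_mset.compositionality o_def nat_pow_pow mult.commute)
    moreover have "\<not> minimal_zero_sum G {# h [^]\<^bsub>G\<^esub> p. h \<in># S #}"
      using assms(10) in_prime_factors_imp_prime[OF p] in_prime_factors_imp_dvd[OF p]
      unfolding reduced_seq_def assms(3) by blast
    ultimately have "\<not> minimal_zero_sum G {# g [^]\<^bsub>G\<^esub> (p * x i). i \<in># mset_set {1..4} #}"
      by metis
    then have "\<not> (n dvd p * sum x {1..4} \<and> (\<forall>B. B \<subset> {1..4} \<and> B \<noteq> {} \<longrightarrow> \<not> n dvd p * sum x B))"
      unfolding min_iff sum_distrib_left .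
    \<comment> \<open>The total stays divisible after multiplication by \<open>p\<close>, so
      minimality can only fail at a proper nonempty subset.\<close>
    with zs obtain B where "B \<subset> {1..4}" and B: "B \<noteq> {}" "n dvd p * sum x B"
      by (meson dvd_mult)
    then have B': "B \<subseteq> {1..4}" "B \<noteq> {1..4}" by (simp_all add: psubset_eq)
    have Icc: "{1..4} = insert 4 {1,2,3::nat}" by auto
    have in_points: "C \<in> points" if "C \<subseteq> {1..4}" "4 \<notin> C" "C \<noteq> {}" for C
      using that unfolding Icc subset_insert[OF that(2)] by (simp add: points_def)
    show ?thesis
    proof (cases "4 \<in> B")
      case False
      with B(2) in_points[OF B'(1) _ B(1)] show ?thesis by blast
    next
      case True
      \<comment> \<open>The complement of \<open>B\<close> omits 4 and inherits the divisibility
        from the total.\<close>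
      have "{1..4} - B \<noteq> {}" using B' by (metis Diff_eq_empty_iff subset_antisym)
      with True have pt: "{1..4} - B \<in> points" by (intro in_points) simp_all
      have "sum x {1..4} = sum x ({1..4} - B) + sum x B"
        using B'(1) by (intro sum.subset_diff) simp_all
      then have "p * sum x {1..4} = p * sum x ({1..4} - B) + p * sum x B"
        by (simp only: distrib_left)
      moreover have "n dvd p * sum x {1..4}" using zs by (rule dvd_mult)
      ultimately have "n dvd p * sum x ({1..4} - B)"
        using B(2) dvd_add_left_iff by metis
      with pt show ?thesis by blast
    qed
  qed
  then obtain J where J: "\<And>p. p \<in> prime_factors n \<Longrightarrow> J p \<in> points"
    "\<And>p. p \<in> prime_factors n \<Longrightarrow> n dvd p * sum x (J p)"
    by metis
  interpret reduced_quadruple n x J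
  proof
    show "n > 0" using assms(4) by simp
    show "n dvd sum x {1..4}" by (rule zs)
    show "\<not> n dvd sum x A" if "A \<in> points" for A
      using that by (intro min points_psubset)
    show "Gcd (insert n (x ` {1..4})) = 1" by (rule assms(11))
    show "J p \<in> points" if "p \<in> prime_factors n" for p
      using that by (rule J(1))
    show "n dvd p * sum x (J p)" if "p \<in> prime_factors n" for p
      using that by (rule J(2))
  qed
  show ?thesis
  proof (intro conjI impI)
    show "card (prime_factors n) \<le> 3" by (rule card_prime_factors_le)
  next
    assume "card (prime_factors n) = 3"
    then obtain p q r where P: "prime_factors n = {p,q,r}"
      and cases: "gcd_mset = {#p * q, q, p * r, r#} \<or> gcd_mset = {#1, p, q, p * q#} \<or>
        (\<forall>i\<in>{1..4}. gcd (x i) n = 1) \<or> gcd_mset = {#1, p * q, p * r, q * r#}"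
      using gcd_mset_cases by blast
    obtain \<sigma> where \<sigma>: "\<sigma> permutes {1..4}"
      "gcd_mset = {#p * q, q, p * r, r#} \<or> gcd_mset = {#1, p, q, p * q#} \<or>
       (\<forall>i\<in>{1..4}. gcd (x i) n = 1) \<or>
       (gcd (x (\<sigma> 1)) n = 1 \<and> gcd (x (\<sigma> 2)) n = p * q \<and>
        gcd (x (\<sigma> 3)) n = p * r \<and> gcd (x (\<sigma> 4)) n = q * r)"
    proof (cases "gcd_mset = {#1, p * q, p * r, q * r#}")
      case True
      from ex_permutation_of_image_mset[OF this] obtain \<sigma> where "\<sigma> permutes {1..4}"
        "gcd (x (\<sigma> 1)) n = 1 \<and> gcd (x (\<sigma> 2)) n = p * q \<and>
         gcd (x (\<sigma> 3)) n = p * r \<and> gcd (x (\<sigma> 4)) n = q * r"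
        by (elim exE conjE) (rule that; simp only: simp_thms)
      then show thesis by (intro that[of \<sigma>] disjI2)
    next
      \<comment> \<open>The other patterns do not mention \<sigma>, so the identity serves.\<close>
      case False
      then consider "gcd_mset = {#p * q, q, p * r, r#}" | "gcd_mset = {#1, p, q, p * q#}"
        | "\<forall>i\<in>{1..4}. gcd (x i) n = 1"
        using cases by argo
      then show thesis
      proof cases
        case 1
        show thesis by (rule that[OF permutes_id disjI1[OF 1]])
      next
        case 2
        show thesis by (rule that[OF permutes_id disjI2[OF disjI1[OF 2]]])
      next
        case 3
        show thesis by (rule that[OF permutes_id disjI2[OF disjI2[OF disjI1[OF 3]]]])
      qed
    qed
    show "\<exists>\<sigma> p1 p2 p3. \<sigma> permutes {1..4} \<and> prime_factors n = {p1, p2, p3} \<and>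
        (gcd_mset = {# p1 * p2, p2, p1 * p3, p3 #} \<or>
         gcd_mset = {# 1, p1, p2, p1 * p2 #} \<or>
         (\<forall>i\<in>{1..4}. gcd (x i) n = 1) \<or>
         (gcd (x (\<sigma> 1)) n = 1 \<and> gcd (x (\<sigma> 2)) n = p1 * p2 \<and>
          gcd (x (\<sigma> 3)) n = p1 * p3 \<and> gcd (x (\<sigma> 4)) n = p2 * p3))"
      by (intro exI conjI) (rule \<sigma>(1), rule P, rule \<sigma>(2))
  qed
qed

end
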